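(* For $m\ge 1$ and $1\le i\le 2^m$ let $P(m,i)=\Pr\left(w(g_{2^m}^{(i)})=w(f_{2^m}^{(i)})\right)$, the probability being over the random matrix $T$. Then $P(1,1)=P(1,2)=1$, and for every $m\ge 2$, $$P(m,i)=\begin{cases}\dfrac{2^{w(f_{2^m}^{(i)})}}{2^{2^{m-1}}}\,P(m-1,i), & 1\le i\le 2^{m-1},\\[2mm] P(m-1,i-2^{m-1}), & 2^{m-1}<i\le 2^m.\end{cases}$$
   Context: All vectors and matrices are over $\mathbb{F}_2$; $w(\cdot)$ denotes Hamming weight. Let $F=\begin{bmatrix}1&0\\1&1\end{bmatrix}$, $N=2^m$, and $F_N=F^{\otimes m}$ (Kronecker power). For $1\le i\le N$, $f_N^{(i)}$ is the $i$-th row of $F_N$. For each $m$, $T$ is a random $N\times N$ upper-triangular matrix over $\mathbb{F}_2$ with all ones on the diagonal, whose entries $T_{ij}$, $1\le i<j\le N$, are i.i.d. Bernoulli$(1/2)$. Let $g_N^{(i)}$ be the $i$-th row of $G_N=TF_N$, so $g_N^{(i)}=f_N^{(i)}\oplus\sum_{j=i+1}^{N}T_{ij}f_N^{(j)}$. *)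

theory Defs
  imports
    "HOL-Probability.Probability"
    "HOL-Library.Z2"
    "Jordan_Normal_Form.Matrix"
begin

definition hamming_weight :: "'a::zero vec \<Rightarrow> nat" where
  "hamming_weight v = card {k. k < dim_vec v \<and> vec_index v k \<noteq> 0}"

definition kronecker_prod :: "'a::times mat \<Rightarrow> 'a mat \<Rightarrow> 'a mat" where
  "kronecker_prod A B =
     mat (dim_row A * dim_row B) (dim_col A * dim_col B)
       (\<lambda>(r, c). A $$ (r div dim_row B, c div dim_col B) * B $$ (r mod dim_row B, c mod dim_col B))"

fun kronecker_power :: "'a::semiring_1 mat \<Rightarrow> nat \<Rightarrow> 'a mat" where
  "kronecker_power A 0 = 1\<^sub>m 1"
| "kronecker_power A (Suc n) = kronecker_prod A (kronecker_power A n)"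

definition polar_kernel :: "bit mat" where
  "polar_kernel = mat_of_rows_list 2 [[1, 0], [1, 1]]"

abbreviation polar_matrix :: "nat \<Rightarrow> bit mat" where
  "polar_matrix m \<equiv> kronecker_power polar_kernel m"

text \<open>
  A random matrix \<open>T\<close> over the two-element field on the probability space \<open>M\<close>: it is always an
  upper-triangular \<open>N\<close> by \<open>N\<close> matrix with ones on the diagonal, and its entries strictly above the
  diagonal are independent, each with the law Bernoulli(1/2) (transported from \<^typ>\<open>bool\<close> to
  \<^typ>\<open>bit\<close>). Entries of matrices are indexed from 0.
\<close>

definition random_unitriangular :: "'a measure \<Rightarrow> nat \<Rightarrow> ('a \<Rightarrow> bit mat) \<Rightarrow> bool" where
  "random_unitriangular M N T \<longleftrightarrow>
     prob_space M \<and>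
     (\<forall>\<omega>\<in>space M. T \<omega> \<in> carrier_mat N N \<and> upper_triangular (T \<omega>) \<and>
        (\<forall>k<N. T \<omega> $$ (k, k) = 1)) \<and>
     prob_space.indep_vars M (\<lambda>_. count_space UNIV) (\<lambda>p \<omega>. T \<omega> $$ p)
       {(r, c). r < c \<and> c < N} \<and>
     (\<forall>r c. r < c \<and> c < N \<longrightarrow>
        distr M (count_space UNIV) (\<lambda>\<omega>. T \<omega> $$ (r, c)) =
          measure_pmf (map_pmf of_bool (bernoulli_pmf (1/2))))"

text \<open>
  The rows below are numbered from 1, so \<open>i\<close> ranges over \<open>{1..2 ^ m}\<close>, while \<^const>\<open>row\<close> counts
  from 0.
\<close>

definition f_row :: "nat \<Rightarrow> nat \<Rightarrow> bit vec" where
  "f_row m i = row (polar_matrix m) (i - 1)"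

definition g_row :: "bit mat \<Rightarrow> nat \<Rightarrow> nat \<Rightarrow> bit vec" where
  "g_row t m i = row (t * polar_matrix m) (i - 1)"

definition same_weight_prob ::
    "(nat \<Rightarrow> 'a measure) \<Rightarrow> (nat \<Rightarrow> 'a \<Rightarrow> bit mat) \<Rightarrow> nat \<Rightarrow> nat \<Rightarrow> real" where
  "same_weight_prob M T m i =
     measure (M m) {\<omega> \<in> space (M m). hamming_weight (g_row (T m \<omega>) m i) = hamming_weight (f_row m i)}"

end

theory Submission
  imports Defs
begin

text \<open>
  With \<open>F'\<close> the polar matrix of half the size, the rows of the polar matrix are \<open>(f', 0)\<close> in the upper
  half and \<open>(f', f')\<close> in the lower half. For a lower row, \<open>g = (g', g')\<close> and all weights double. For an
  upper row, \<open>g = (g' + u, u)\<close>, where \<open>u\<close> is uniform because the rows of \<open>F'\<close> form a basis, and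
  \<open>w (g' + u) + w u \<ge> w g' \<ge> w f'\<close>. Equality holds iff \<open>w g' = w f'\<close> and the support of \<open>u\<close> lies in that
  of \<open>g'\<close>, which happens for \<open>2 ^ w f'\<close> of the \<open>2 ^ 2 ^ (m - 1)\<close> vectors \<open>u\<close>. The argument is carried out
  on supports: a binary vector is the set of its nonzero positions and addition is symmetric difference.
\<close>

section \<open>Encoding of vectors by supports and halves\<close>

text \<open>Rows are numbered from 0 here. The bound on \<open>c\<close> keeps out entries beyond
  the matrix, which have no specified value.\<close>

definition combination_support :: "nat \<Rightarrow> nat set \<Rightarrow> nat set" where
  "combination_support m A = {c. c < 2 ^ m \<and> (\<Sum>j\<in>A. polar_matrix m $$ (j, c)) \<noteq> 0}"

text \<open>Concatenation of two vectors of length \<open>n\<close>, seen through their supports. It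
  serves for sets of row indices and for sets of columns alike.\<close>

definition append_shifted :: "nat \<Rightarrow> nat set \<Rightarrow> nat set \<Rightarrow> nat set" where
  "append_shifted n L U = L \<union> (+) n ` U"

section \<open>Block form of the polar matrix\<close>

lemma dim_polar_matrix [simp]:
  "dim_row (polar_matrix m) = 2 ^ m" "dim_col (polar_matrix m) = 2 ^ m"
  by (induction m) (simp_all add: kronecker_prod_def polar_kernel_def mat_of_rows_list_def)

lemma polar_kernel_index:
  "polar_kernel $$ (0, 0) = 1" "polar_kernel $$ (0, Suc 0) = 0"
  "polar_kernel $$ (Suc 0, 0) = 1" "polar_kernel $$ (Suc 0, Suc 0) = 1"
  "dim_row polar_kernel = 2" "dim_col polar_kernel = 2"
  by (simp_all add: polar_kernel_def mat_of_rows_list_def)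

text \<open>Division by \<open>2 ^ m\<close> selects the entry of the kernel, hence the block; the
  remainder selects the position inside the block.\<close>

lemma polar_matrix_Suc_index:
  assumes "r < 2 ^ m" "c < 2 ^ m"
  shows "polar_matrix (Suc m) $$ (r, c) = polar_matrix m $$ (r, c)"
    and "polar_matrix (Suc m) $$ (r, 2 ^ m + c) = 0"
    and "polar_matrix (Suc m) $$ (2 ^ m + r, c) = polar_matrix m $$ (r, c)"
    and "polar_matrix (Suc m) $$ (2 ^ m + r, 2 ^ m + c) = polar_matrix m $$ (r, c)"
proof -
  have div: "(2 ^ m + k) div 2 ^ m = Suc 0" if "k < 2 ^ m" for k :: nat
    using that by simp
  show "polar_matrix (Suc m) $$ (r, c) = polar_matrix m $$ (r, c)"
    and "polar_matrix (Suc m) $$ (r, 2 ^ m + c) = 0"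
    and "polar_matrix (Suc m) $$ (2 ^ m + r, c) = polar_matrix m $$ (r, c)"
    and "polar_matrix (Suc m) $$ (2 ^ m + r, 2 ^ m + c) = polar_matrix m $$ (r, c)"
    using assms by (simp_all add: kronecker_prod_def polar_kernel_index div)
qed

section \<open>Splitting index sets into halves\<close>

text \<open>The inverse cuts a set at \<open>n\<close> and moves the upper part down. Counting
  subsets of the doubled range thereby becomes counting pairs of halves.\<close>

lemma append_shifted_bij:
  "bij_betw (\<lambda>(L, U). append_shifted n L U) (Pow {..<n} \<times> Pow {..<n}) (Pow {..<2 * n})"
proof (rule bij_betw_byWitness[where f' = "\<lambda>A. (A \<inter> {..<n}, {j. n + j \<in> A})"])
  show "\<forall>p\<in>Pow {..<n} \<times> Pow {..<n}.
    (\<lambda>A. (A \<inter> {..<n}, {j. n + j \<in> A})) ((\<lambda>(L, U). append_shifted n L U) p) = p"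
    by (auto simp: append_shifted_def)
  have "A = append_shifted n (A \<inter> {..<n}) {j. n + j \<in> A}" for A
  proof (rule Set.set_eqI)
    fix j
    consider "j < n" | k where "j = n + k" using le_Suc_ex not_le by blast
    then show "j \<in> A \<longleftrightarrow> j \<in> append_shifted n (A \<inter> {..<n}) {j. n + j \<in> A}"
      by cases (auto simp: append_shifted_def)
  qed
  then show "\<forall>A\<in>Pow {..<2 * n}. (\<lambda>(L, U). append_shifted n L U) (A \<inter> {..<n}, {j. n + j \<in> A}) = A"
    by auto
qed (auto simp: append_shifted_def)

lemma append_shifted_inj:
  assumes "L \<subseteq> {..<n}" "U \<subseteq> {..<n}" "L' \<subseteq> {..<n}" "U' \<subseteq> {..<n}"
    and "append_shifted n L U = append_shifted n L' U'"
  shows "L = L'" "U = U'"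
  using inj_onD[OF bij_betw_imp_inj_on[OF append_shifted_bij[of n]], of "(L, U)" "(L', U')"] assms
  by auto

lemma append_shifted_cases:
  assumes "A \<subseteq> {..<2 * n}"
  obtains L U where "L \<subseteq> {..<n}" "U \<subseteq> {..<n}" "A = append_shifted n L U"
proof -
  have "A \<in> (\<lambda>(L, U). append_shifted n L U) ` (Pow {..<n} \<times> Pow {..<n})"
    using bij_betw_imp_surj_on[OF append_shifted_bij[of n]] assms by simp
  with that show thesis by auto
qed

lemma card_append_shifted:
  assumes "L \<subseteq> {..<n}" "U \<subseteq> {..<n}"
  shows "card (append_shifted n L U) = card L + card U"
proof -
  have "L \<inter> (+) n ` U = {}" using assms by auto
  moreover have "finite L" "finite U" using assms finite_subset by auto
  ultimately show ?thesis
    by (simp add: append_shifted_def card_Un_disjoint card_image)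
qed

section \<open>Supports and weights of row combinations\<close>

lemma combination_support_subset [simp]: "combination_support m A \<subseteq> {..<2 ^ m}"
  by (auto simp: combination_support_def)

lemma finite_combination_support [simp]: "finite (combination_support m A)"
  by (rule finite_subset[OF combination_support_subset]) simp

lemma combination_support_empty [simp]: "combination_support m {} = {}"
  by (simp add: combination_support_def)

text \<open>By the block form, the left columns receive the rows of both halves, while the right
  columns receive only those of \<open>U\<close>.\<close>

lemma combination_support_Suc:
  assumes "L \<subseteq> {..<2 ^ m}" "U \<subseteq> {..<2 ^ m}"
  shows "combination_support (Suc m) (append_shifted (2 ^ m) L U) =
    append_shifted (2 ^ m) (sym_diff (combination_support m L) (combination_support m U))
      (combination_support m U)"
proof -
  have fin: "finite L" "finite U" using assms finite_subset by auto
  have disj: "L \<inter> (+) (2 ^ m) ` U = {}" using assms by auto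
  have split: "(\<Sum>j\<in>append_shifted (2 ^ m) L U. h j) = (\<Sum>j\<in>L. h j) + (\<Sum>j\<in>U. h (2 ^ m + j))"
    for h :: "nat \<Rightarrow> bit"
    unfolding append_shifted_def using fin disj
    by (simp add: sum.union_disjoint sum.reindex)
  have low: "(\<Sum>j\<in>append_shifted (2 ^ m) L U. polar_matrix (Suc m) $$ (j, c)) =
      (\<Sum>j\<in>L. polar_matrix m $$ (j, c)) + (\<Sum>j\<in>U. polar_matrix m $$ (j, c))" if "c < 2 ^ m" for c
    unfolding split using assms that
    by (intro arg_cong2[where f = "(+)"] sum.cong refl polar_matrix_Suc_index) auto
  have high: "(\<Sum>j\<in>append_shifted (2 ^ m) L U. polar_matrix (Suc m) $$ (j, 2 ^ m + c)) =
      (\<Sum>j\<in>U. polar_matrix m $$ (j, c))" if "c < 2 ^ m" for c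
  proof -
    have "(\<Sum>j\<in>L. polar_matrix (Suc m) $$ (j, 2 ^ m + c)) = 0"
      using assms that by (intro sum.neutral ballI polar_matrix_Suc_index) auto
    moreover have "(\<Sum>j\<in>U. polar_matrix (Suc m) $$ (2 ^ m + j, 2 ^ m + c)) =
      (\<Sum>j\<in>U. polar_matrix m $$ (j, c))"
      using assms that by (intro sum.cong refl polar_matrix_Suc_index) auto
    ultimately show ?thesis unfolding split by simp
  qed
  \<comment> \<open>Two nonzero bits cancel, so addition of vectors becomes symmetric difference of
    supports.\<close>
  have bit: "a + b \<noteq> 0 \<longleftrightarrow> (a \<noteq> 0) \<noteq> (b \<noteq> 0)" for a b :: bit
    by (cases a; cases b) simp_all
  show ?thesis
  proof (rule Set.set_eqI)
    fix c :: nat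
    consider "c < 2 ^ m" | d where "c = 2 ^ m + d" "d < 2 ^ m" | "c \<ge> 2 * 2 ^ m"
    proof -
      have "c < 2 ^ m \<or> (c = 2 ^ m + (c - 2 ^ m) \<and> c - 2 ^ m < 2 ^ m) \<or> c \<ge> 2 * 2 ^ m"
        by linarith
      with that show thesis by blast
    qed
    then show "c \<in> combination_support (Suc m) (append_shifted (2 ^ m) L U) \<longleftrightarrow>
      c \<in> append_shifted (2 ^ m) (sym_diff (combination_support m L) (combination_support m U))
        (combination_support m U)"
    proof cases
      case 1
      with low[OF 1] show ?thesis
        by (auto simp: combination_support_def append_shifted_def bit simp del: kronecker_power.simps)
    next
      case 2
      with high[OF 2(2)] show ?thesis
        by (auto simp: combination_support_def append_shifted_def simp del: kronecker_power.simps)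
    next
      case 3
      then show ?thesis
        by (auto simp: combination_support_def append_shifted_def)
    qed
  qed
qed

text \<open>This says that the rows form a basis. Injectivity goes by induction on the block form;
  surjectivity follows because the map sends a finite set into itself.\<close>

lemma bij_combination_support:
  "bij_betw (combination_support m) (Pow {..<2 ^ m}) (Pow {..<2 ^ m})"
proof -
  have "inj_on (combination_support m) (Pow {..<2 ^ m})"
  proof (induction m)
    case 0
    have "Pow {..<2 ^ 0} = {{}, {0 :: nat}}" by (auto simp: lessThan_Suc)
    moreover have "combination_support 0 {0} = {0}" by (auto simp: combination_support_def)
    ultimately show ?case by simp
  next
    case (Suc m)
    show ?case
    proof (rule inj_onI)
      fix A B
      assume AB: "A \<in> Pow {..<2 ^ Suc m}" "B \<in> Pow {..<2 ^ Suc m}"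
        and eq: "combination_support (Suc m) A = combination_support (Suc m) B"
      obtain L U where A: "L \<subseteq> {..<2 ^ m}" "U \<subseteq> {..<2 ^ m}" "A = append_shifted (2 ^ m) L U"
        using append_shifted_cases AB(1) by (metis Pow_iff power_Suc)
      obtain L' U' where B: "L' \<subseteq> {..<2 ^ m}" "U' \<subseteq> {..<2 ^ m}" "B = append_shifted (2 ^ m) L' U'"
        using append_shifted_cases AB(2) by (metis Pow_iff power_Suc)
      let ?X = "combination_support m"
      have sub: "sym_diff (?X V) (?X W) \<subseteq> {..<2 ^ m}" for V W
        using combination_support_subset by blast
      have "append_shifted (2 ^ m) (sym_diff (?X L) (?X U)) (?X U) =
        append_shifted (2 ^ m) (sym_diff (?X L') (?X U')) (?X U')"
        using eq A B by (simp add: combination_support_Suc)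
      note eqs = append_shifted_inj[OF sub combination_support_subset sub combination_support_subset this]
      \<comment> \<open>The right halves give \<open>?X U = ?X U'\<close>; cancelling this set in
        the symmetric differences leaves the claim.\<close>
      then have "?X L = ?X L'" by blast
      with eqs(2) A B show "A = B"
        using Suc.IH by (metis PowI inj_onD)
    qed
  qed
  then show ?thesis
    using combination_support_subset
    by (simp add: bij_betw_def endo_inj_surj image_subsetI)
qed

text \<open>A point of \<open>X\<close> is counted once on the left whether or not it lies in
  \<open>Y\<close>, and a point of \<open>Y - X\<close> is counted twice.\<close>

lemma card_sym_diff_add:
  assumes "finite X" "finite Y"
  shows "card (sym_diff X Y) + card Y = card X + 2 * card (Y - X)"
proof -
  have "card (sym_diff X Y) = card (X - Y) + card (Y - X)"
    using assms by (intro card_Un_disjoint) auto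
  moreover have "card X = card (X - Y) + card (X \<inter> Y)"
    using assms by (metis add.commute card_Int_Diff)
  moreover have "card Y = card (Y - X) + card (X \<inter> Y)"
    using assms by (metis add.commute card_Int_Diff inf_commute)
  ultimately show ?thesis by simp
qed

text \<open>This is the weight of \<open>(g' + u, u)\<close>, with \<open>g'\<close> from
  \<open>L\<close> and \<open>u\<close> from \<open>U\<close>. It covers both kinds of row: an empty
  \<open>U\<close> keeps the weight, an empty \<open>L\<close> doubles it.\<close>

lemma card_combination_support_Suc:
  assumes "L \<subseteq> {..<2 ^ m}" "U \<subseteq> {..<2 ^ m}"
  shows "card (combination_support (Suc m) (append_shifted (2 ^ m) L U)) =
    card (combination_support m L) + 2 * card (combination_support m U - combination_support m L)"
proof -
  have "sym_diff (combination_support m L) (combination_support m U) \<subseteq> {..<2 ^ m}"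
    using combination_support_subset by blast
  then show ?thesis
    by (simp add: combination_support_Suc[OF assms] card_append_shifted card_sym_diff_add)
qed

lemma append_shifted_singleton:
  "append_shifted n {r} {} = {r}" "append_shifted n {} {r} = {n + r}"
  by (simp_all add: append_shifted_def)

lemma card_combination_support_singleton_Suc:
  assumes "r < 2 ^ m"
  shows "card (combination_support (Suc m) {r}) = card (combination_support m {r})"
    and "card (combination_support (Suc m) {2 ^ m + r}) = 2 * card (combination_support m {r})"
  using card_combination_support_Suc[of "{r}" m "{}"] card_combination_support_Suc[of "{}" m "{r}"] assms
  by (simp_all add: append_shifted_singleton)

section \<open>Index sets with a given minimum and the lower bound on weights\<close>

text \<open>These are the row sets that row \<open>r\<close> of a unitriangular matrix can select:
  the diagonal contributes \<open>r\<close>, and triangularity excludes smaller indices.\<close>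

definition index_sets_with_min :: "nat \<Rightarrow> nat \<Rightarrow> nat set set" where
  "index_sets_with_min n r = {A. r \<in> A \<and> A \<subseteq> {r..<n}}"

text \<open>A minimum in the first half leaves the second half free; a minimum in the second half
  empties the first. These are the two cases of the recursion.\<close>

lemma index_sets_with_min_double:
  assumes "r < n"
  shows "index_sets_with_min (2 * n) r = (\<lambda>(L, U). append_shifted n L U) ` (index_sets_with_min n r \<times> Pow {..<n})"
    and "index_sets_with_min (2 * n) (n + r) = append_shifted n {} ` index_sets_with_min n r"
proof -
  show "index_sets_with_min (2 * n) r = (\<lambda>(L, U). append_shifted n L U) ` (index_sets_with_min n r \<times> Pow {..<n})"
  proof (intro equalityI subsetI)
    fix A assume A: "A \<in> index_sets_with_min (2 * n) r"
    then have "A \<subseteq> {..<2 * n}" by (auto simp: index_sets_with_min_def)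
    then obtain L U where LU: "L \<subseteq> {..<n}" "U \<subseteq> {..<n}" "A = append_shifted n L U"
      by (rule append_shifted_cases)
    moreover have "L \<in> index_sets_with_min n r"
      using A LU assms by (fastforce simp: index_sets_with_min_def append_shifted_def)
    ultimately show "A \<in> (\<lambda>(L, U). append_shifted n L U) ` (index_sets_with_min n r \<times> Pow {..<n})"
      by auto
  qed (use assms in \<open>auto simp: index_sets_with_min_def append_shifted_def subset_iff\<close>)
  show "index_sets_with_min (2 * n) (n + r) = append_shifted n {} ` index_sets_with_min n r"
  proof (intro equalityI subsetI)
    fix A assume A: "A \<in> index_sets_with_min (2 * n) (n + r)"
    then have "A \<subseteq> {..<2 * n}" by (auto simp: index_sets_with_min_def)
    then obtain L U where LU: "L \<subseteq> {..<n}" "U \<subseteq> {..<n}" "A = append_shifted n L U"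
      by (rule append_shifted_cases)
    moreover have "L = {}"
      using A LU by (fastforce simp: index_sets_with_min_def append_shifted_def)
    moreover have "U \<in> index_sets_with_min n r"
      using A LU \<open>L = {}\<close> by (auto simp: index_sets_with_min_def append_shifted_def)
    ultimately show "A \<in> append_shifted n {} ` index_sets_with_min n r" by auto
  qed (auto simp: index_sets_with_min_def append_shifted_def)
qed

lemma index_sets_with_min_subset: "A \<in> index_sets_with_min n r \<Longrightarrow> A \<subseteq> {..<n}"
  by (auto simp: index_sets_with_min_def)

text \<open>Induction on \<open>m\<close>: for \<open>r\<close> in the first half the additional
  term in the weight is nonnegative, and in the second half both weights double.\<close>

lemma card_combination_support_ge:
  assumes "r < 2 ^ m" "A \<in> index_sets_with_min (2 ^ m) r"
  shows "card (combination_support m {r}) \<le> card (combination_support m A)"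
  using assms
proof (induction m arbitrary: r A)
  case 0
  then have "A = {r}" by (auto simp: index_sets_with_min_def)
  then show ?case by simp
next
  case (Suc m)
  show ?case
  proof (cases "r < 2 ^ m")
    case True
    from Suc.prems obtain L U where LU: "L \<in> index_sets_with_min (2 ^ m) r" "U \<subseteq> {..<2 ^ m}"
      "A = append_shifted (2 ^ m) L U"
      using index_sets_with_min_double(1)[OF True] by auto
    then show ?thesis
      using Suc.IH[OF True LU(1)] index_sets_with_min_subset[OF LU(1)] True
      by (simp add: card_combination_support_Suc card_combination_support_singleton_Suc)
  next
    case False
    then obtain s where s: "r = 2 ^ m + s" by (metis le_add_diff_inverse not_le)
    with Suc.prems have s2: "s < 2 ^ m" by simp
    from Suc.prems s obtain U where U: "U \<in> index_sets_with_min (2 ^ m) s" "A = append_shifted (2 ^ m) {} U"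
      using index_sets_with_min_double(2)[OF s2] by auto
    then show ?thesis
      using Suc.IH[OF s2 U(1)] index_sets_with_min_subset[OF U(1)] s s2
      by (simp add: card_combination_support_Suc card_combination_support_singleton_Suc)
  qed
qed

section \<open>Counting the combinations of equal weight\<close>

text \<open>The favourable outcomes: with \<open>r = i - 1\<close>, the probability sought is the
  size of this set over the number of possible rows.\<close>

definition equal_weight_combinations :: "nat \<Rightarrow> nat \<Rightarrow> nat set set" where
  "equal_weight_combinations m r =
    {A \<in> index_sets_with_min (2 ^ m) r. card (combination_support m A) = card (combination_support m {r})}"

lemma equal_weight_combinations_Suc_low:
  assumes "r < 2 ^ m"
  shows "equal_weight_combinations (Suc m) r = (\<lambda>(L, U). append_shifted (2 ^ m) L U) `
    (SIGMA L:equal_weight_combinations m r.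
      {U \<in> Pow {..<2 ^ m}. combination_support m U \<subseteq> combination_support m L})"
proof -
  have iff: "card (combination_support (Suc m) (append_shifted (2 ^ m) L U)) =
        card (combination_support (Suc m) {r}) \<longleftrightarrow>
      card (combination_support m L) = card (combination_support m {r}) \<and>
        combination_support m U \<subseteq> combination_support m L"
    if "L \<in> index_sets_with_min (2 ^ m) r" "U \<subseteq> {..<2 ^ m}" for L U
  proof -
    have "card (combination_support m U - combination_support m L) = 0 \<longleftrightarrow>
        combination_support m U \<subseteq> combination_support m L"
      by simp
    moreover have "card (combination_support (Suc m) (append_shifted (2 ^ m) L U)) =
        card (combination_support m L) + 2 * card (combination_support m U - combination_support m L)"
      by (rule card_combination_support_Suc[OF index_sets_with_min_subset[OF that(1)] that(2)])
    \<comment> \<open>The weight exceeds that of row \<open>r\<close> by two nonnegative amounts, so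
      equality forces both to vanish.\<close>
    ultimately show ?thesis
      using card_combination_support_ge[OF assms that(1)] card_combination_support_singleton_Suc(1)[OF assms]
      by linarith
  qed
  show ?thesis
    unfolding equal_weight_combinations_def power_Suc index_sets_with_min_double(1)[OF assms]
    using iff by auto
qed

lemma card_equal_weight_combinations_Suc:
  assumes "r < 2 ^ m"
  shows "card (equal_weight_combinations (Suc m) r) =
      2 ^ card (combination_support m {r}) * card (equal_weight_combinations m r)"
    and "card (equal_weight_combinations (Suc m) (2 ^ m + r)) = card (equal_weight_combinations m r)"
proof -
  let ?E = "equal_weight_combinations m r"
  let ?sub = "\<lambda>L. {U \<in> Pow {..<2 ^ m}. combination_support m U \<subseteq> combination_support m L}"
  have E: "?E \<subseteq> Pow {..<2 ^ m}"
    by (auto simp: equal_weight_combinations_def dest: index_sets_with_min_subset)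
  then have fin: "finite ?E" by (rule finite_subset) simp
  have card_sub: "card (?sub L) = 2 ^ card (combination_support m L)" for L
  proof -
    \<comment> \<open>The basis property makes the admissible \<open>U\<close> correspond to
      arbitrary subsets of the support of \<open>L\<close>.\<close>
    have image: "combination_support m ` ?sub L = Pow (combination_support m L)"
    proof (intro equalityI subsetI)
      fix Y assume "Y \<in> Pow (combination_support m L)"
      then have "Y \<subseteq> combination_support m L" by simp
      moreover from this have "Y \<in> Pow {..<2 ^ m}"
        using combination_support_subset by blast
      then have "Y \<in> combination_support m ` Pow {..<2 ^ m}"
        using bij_betw_imp_surj_on[OF bij_combination_support] by simp
      ultimately show "Y \<in> combination_support m ` ?sub L" by blast
    qed auto
    have "inj_on (combination_support m) (?sub L)"
      by (rule inj_on_subset[OF bij_betw_imp_inj_on[OF bij_combination_support]]) auto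
    from card_image[OF this] show ?thesis
      by (simp only: image card_Pow finite_combination_support)
  qed
  have "inj_on (\<lambda>(L, U). append_shifted (2 ^ m) L U) (Sigma ?E ?sub)"
    by (rule inj_on_subset[OF bij_betw_imp_inj_on[OF append_shifted_bij]]) (use E in auto)
  then have "card (equal_weight_combinations (Suc m) r) = card (Sigma ?E ?sub)"
    unfolding equal_weight_combinations_Suc_low[OF assms] by (rule card_image)
  also have "\<dots> = (\<Sum>L\<in>?E. 2 ^ card (combination_support m L))"
    by (subst card_SigmaI[OF fin]) (simp_all only: card_sub, simp)
  \<comment> \<open>All \<open>L\<close> in \<open>?E\<close> have the weight of row
    \<open>r\<close>, so all fibres have the same size.\<close>
  also have "\<dots> = (\<Sum>L\<in>?E. 2 ^ card (combination_support m {r}))"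
    by (intro sum.cong) (auto simp: equal_weight_combinations_def)
  finally show "card (equal_weight_combinations (Suc m) r) =
      2 ^ card (combination_support m {r}) * card ?E"
    by simp
  have "equal_weight_combinations (Suc m) (2 ^ m + r) = append_shifted (2 ^ m) {} ` ?E"
  proof -
    have "card (combination_support (Suc m) (append_shifted (2 ^ m) {} U)) =
        card (combination_support (Suc m) {2 ^ m + r}) \<longleftrightarrow>
      card (combination_support m U) = card (combination_support m {r})"
      if "U \<in> index_sets_with_min (2 ^ m) r" for U
      using card_combination_support_Suc[OF _ index_sets_with_min_subset[OF that], of "{}"]
        card_combination_support_singleton_Suc(2)[OF assms] by simp
    then show ?thesis
      unfolding equal_weight_combinations_def power_Suc index_sets_with_min_double(2)[OF assms] by blast
  qed
  moreover have "inj (append_shifted (2 ^ m) {})"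
    by (auto simp: inj_def append_shifted_def inj_image_eq_iff)
  ultimately show "card (equal_weight_combinations (Suc m) (2 ^ m + r)) = card ?E"
    by (simp add: card_image inj_on_subset[OF _ subset_UNIV])
qed

section \<open>Independent fair bits\<close>

lemma (in prob_space) indep_vars_image:
  assumes inj: "inj_on h J" and indep: "indep_vars M' X (h ` J)"
  shows "indep_vars (\<lambda>i. M' (h i)) (\<lambda>i. X (h i)) J"
  unfolding indep_vars_def2
proof (intro conjI ballI indep_setsI)
  fix A K
  assume K: "K \<noteq> {}" "K \<subseteq> J" "finite K"
    and A: "\<forall>i\<in>K. A i \<in> {X (h i) -` B \<inter> space M |B. B \<in> sets (M' (h i))}"
  have inv: "inv_into J h (h i) = i" if "i \<in> K" for i
    using inj K that by auto
  have "prob (\<Inter>k\<in>h ` K. A (inv_into J h k)) = (\<Prod>k\<in>h ` K. prob (A (inv_into J h k)))"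
    using indep K A inv unfolding indep_vars_def2 by (intro indep_setsD[where I = "h ` J"]) auto
  moreover have "inj_on h K" using inj K(2) by (rule inj_on_subset)
  ultimately show "prob (\<Inter>i\<in>K. A i) = (\<Prod>i\<in>K. prob (A i))"
    by (simp add: prod.reindex inv)
qed (use indep in \<open>auto simp: indep_vars_def2 indep_sets_def\<close>)

text \<open>By independence each of the \<open>2 ^ card J\<close> patterns is equally likely, and
  distinct patterns are disjoint events.\<close>

lemma (in prob_space) prob_support_uniform_bits:
  fixes X :: "'i \<Rightarrow> 'a \<Rightarrow> bit"
  assumes "finite J" and indep: "indep_vars (\<lambda>_. count_space UNIV) X J"
    and distr: "\<And>j. j \<in> J \<Longrightarrow>
      distr M (count_space UNIV) (X j) = measure_pmf (map_pmf of_bool (bernoulli_pmf (1/2)))"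
    and "\<A> \<subseteq> Pow J"
  shows "prob {\<omega> \<in> space M. {j \<in> J. X j \<omega> \<noteq> 0} \<in> \<A>} = card \<A> / 2 ^ card J"
proof -
  have meas [measurable]: "X j \<in> M \<rightarrow>\<^sub>M count_space UNIV" if "j \<in> J" for j
    using indep that by (simp add: indep_vars_def)
  have half: "prob (X j -` {b} \<inter> space M) = 1 / 2" if "j \<in> J" for j b
  proof -
    have "prob (X j -` {b} \<inter> space M) = pmf (map_pmf of_bool (bernoulli_pmf (1/2))) b"
      using measure_distr[OF meas[OF that], of "{b}"] distr[OF that]
      by (simp add: measure_pmf_single)
    also have "\<dots> = 1 / 2"
    proof (cases b)
      assume b: "b = 0"
      have "of_bool -` {0 :: bit} = {False}" by auto
      then show ?thesis by (simp add: b pmf_map measure_pmf_single)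
    next
      assume b: "b = 1"
      have "of_bool -` {1 :: bit} = {True}" by auto
      then show ?thesis by (simp add: b pmf_map measure_pmf_single)
    qed
    finally show ?thesis .
  qed
  let ?E = "\<lambda>S. {\<omega> \<in> space M. {j \<in> J. X j \<omega> \<noteq> 0} = S}"
  have E_eq: "?E S = {\<omega> \<in> space M. \<forall>j\<in>J. X j \<omega> = of_bool (j \<in> S)}" if "S \<subseteq> J" for S
    using that by (auto split: if_splits simp: of_bool_def)
  have meas_E: "?E S \<in> events" if "S \<subseteq> J" for S
    unfolding E_eq[OF that] using \<open>finite J\<close> by measurable
  have prob_E: "prob (?E S) = 1 / 2 ^ card J" if "S \<subseteq> J" for S
  \<comment> \<open>An intersection over an empty index set would be \<open>UNIV\<close> instead of
    the sample space, so this case is separate.\<close>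
  proof (cases "J = {}")
    case True
    then show ?thesis using that by (simp add: prob_space)
  next
    case False
    have "?E S = (\<Inter>j\<in>J. X j -` {of_bool (j \<in> S)} \<inter> space M)"
      unfolding E_eq[OF that] using False by auto
    also have "prob \<dots> = (\<Prod>j\<in>J. prob (X j -` {of_bool (j \<in> S)} \<inter> space M))"
      using indep False \<open>finite J\<close> by (intro indep_varsD) auto
    also have "\<dots> = 1 / 2 ^ card J"
      by (simp add: half power_divide)
    finally show ?thesis .
  qed
  have fin: "finite \<A>" using assms by (meson finite_Pow_iff finite_subset)
  have "{\<omega> \<in> space M. {j \<in> J. X j \<omega> \<noteq> 0} \<in> \<A>} = (\<Union>S\<in>\<A>. ?E S)" by auto
  also have "prob \<dots> = (\<Sum>S\<in>\<A>. prob (?E S))"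
    using fin meas_E \<open>\<A> \<subseteq> Pow J\<close>
    by (intro finite_measure_finite_Union) (auto simp: disjoint_family_on_def)
  also have "\<dots> = (\<Sum>S\<in>\<A>. 1 / 2 ^ card J)"
    using prob_E \<open>\<A> \<subseteq> Pow J\<close> by (intro sum.cong) auto
  finally show ?thesis by simp
qed

section \<open>From random rows to counting\<close>

lemma hamming_weight_f_row:
  assumes "1 \<le> i" "i \<le> 2 ^ m"
  shows "hamming_weight (f_row m i) = card (combination_support m {i - 1})"
proof -
  have "{k. k < dim_vec (f_row m i) \<and> f_row m i $ k \<noteq> 0} = combination_support m {i - 1}"
    using assms by (auto simp: f_row_def combination_support_def)
  then show ?thesis by (simp add: hamming_weight_def)
qed

text \<open>A coefficient in F_2 either selects a row or drops it. As \<open>i\<close> counts from 1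
  and columns from 0, the diagonal is at \<open>i - 1\<close> and the free entries start at
  \<open>i\<close>.\<close>

lemma hamming_weight_g_row:
  assumes "1 \<le> i" "i \<le> 2 ^ m" and t: "t \<in> carrier_mat (2 ^ m) (2 ^ m)" "upper_triangular t"
    and diag: "t $$ (i - 1, i - 1) = 1"
  shows "hamming_weight (g_row t m i) =
    card (combination_support m (insert (i - 1) {c \<in> {i..<2 ^ m}. t $$ (i - 1, c) \<noteq> 0}))"
proof -
  let ?S = "insert (i - 1) {c \<in> {i..<2 ^ m}. t $$ (i - 1, c) \<noteq> 0}"
  have i: "i - 1 < 2 ^ m" using assms by simp
  have S: "?S = {c \<in> {0..<2 ^ m}. t $$ (i - 1, c) \<noteq> 0}"
  proof -
    have "c = i - 1 \<or> i \<le> c" if "t $$ (i - 1, c) \<noteq> 0" for c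
    proof (rule ccontr)
      assume "\<not> ?thesis"
      then have "c < i - 1" by linarith
      then have "t $$ (i - 1, c) = 0" using t i by auto
      with that show False by contradiction
    qed
    then show ?thesis using i diag by auto
  qed
  have "g_row t m i $ k = (\<Sum>j\<in>?S. polar_matrix m $$ (j, k))" if "k < 2 ^ m" for k
  proof -
    have "g_row t m i $ k = (\<Sum>j = 0..<2 ^ m. t $$ (i - 1, j) * polar_matrix m $$ (j, k))"
      using that i t by (simp add: g_row_def scalar_prod_def)
    also have "\<dots> = (\<Sum>j\<in>?S. polar_matrix m $$ (j, k))"
      unfolding S sum.inter_filter[OF finite_atLeastLessThan]
      by (intro sum.cong) auto
    finally show ?thesis .
  qed
  moreover have "dim_vec (g_row t m i) = 2 ^ m" by (simp add: g_row_def)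
  ultimately have "{k. k < dim_vec (g_row t m i) \<and> g_row t m i $ k \<noteq> 0} = combination_support m ?S"
    by (auto simp: combination_support_def)
  then show ?thesis by (simp add: hamming_weight_def)
qed

text \<open>The event depends only on which of the \<open>2 ^ m - i\<close> fair bits right of the
  diagonal are one.\<close>

lemma same_weight_prob_eq:
  assumes T: "random_unitriangular (M m) (2 ^ m) (T m)" and i: "1 \<le> i" "i \<le> 2 ^ m"
  shows "same_weight_prob M T m i = card (equal_weight_combinations m (i - 1)) / 2 ^ (2 ^ m - i)"
proof -
  interpret prob_space "M m" using T by (simp add: random_unitriangular_def)
  let ?J = "{i..<2 ^ m}"
  let ?X = "\<lambda>c \<omega>. T m \<omega> $$ (i - 1, c)"
  let ?A = "{S \<in> Pow ?J. insert (i - 1) S \<in> equal_weight_combinations m (i - 1)}"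
  have "indep_vars (\<lambda>_. count_space UNIV) (\<lambda>p \<omega>. T m \<omega> $$ p) {(r, c). r < c \<and> c < 2 ^ m}"
    using T by (simp add: random_unitriangular_def)
  then have "indep_vars (\<lambda>_. count_space UNIV) (\<lambda>p \<omega>. T m \<omega> $$ p) (Pair (i - 1) ` ?J)"
    by (rule indep_vars_subset) (use i in auto)
  from indep_vars_image[OF _ this] have indep: "indep_vars (\<lambda>_. count_space UNIV) ?X ?J"
    by (simp add: inj_on_def)
  have iff: "hamming_weight (g_row (T m \<omega>) m i) = hamming_weight (f_row m i) \<longleftrightarrow>
      {c \<in> ?J. ?X c \<omega> \<noteq> 0} \<in> ?A" if "\<omega> \<in> space (M m)" for \<omega>
  proof -
    have "hamming_weight (g_row (T m \<omega>) m i) =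
      card (combination_support m (insert (i - 1) {c \<in> ?J. ?X c \<omega> \<noteq> 0}))"
      using T that i by (intro hamming_weight_g_row) (auto simp: random_unitriangular_def)
    then show ?thesis
      using i by (auto simp: hamming_weight_f_row equal_weight_combinations_def index_sets_with_min_def)
  qed
  have "same_weight_prob M T m i = prob {\<omega> \<in> space (M m). {c \<in> ?J. ?X c \<omega> \<noteq> 0} \<in> ?A}"
    unfolding same_weight_prob_def using iff by (intro arg_cong[where f = prob]) auto
  also have "\<dots> = card ?A / 2 ^ card ?J"
    using T i by (intro prob_support_uniform_bits indep) (auto simp: random_unitriangular_def)
  also have "card ?A = card (equal_weight_combinations m (i - 1))"
  \<comment> \<open>The random part \<open>?J\<close> omits the diagonal index \<open>i - 1\<close>,
    which every counted set contains; inserting and removing it are inverse.\<close>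
  proof (rule bij_betw_same_card[of "insert (i - 1)"], rule bij_betw_byWitness[where f' = "\<lambda>A. A - {i - 1}"])
    show "(\<lambda>A. A - {i - 1}) ` equal_weight_combinations m (i - 1) \<subseteq> ?A"
    proof (clarsimp, intro conjI)
      fix A assume A: "A \<in> equal_weight_combinations m (i - Suc 0)"
      show "A - {i - Suc 0} \<subseteq> ?J"
        using A i by (force simp: equal_weight_combinations_def index_sets_with_min_def)
      show "insert (i - Suc 0) A \<in> equal_weight_combinations m (i - Suc 0)"
        using A by (simp add: equal_weight_combinations_def index_sets_with_min_def insert_absorb)
    qed
  qed (use i in \<open>auto simp: equal_weight_combinations_def index_sets_with_min_def\<close>)
  finally show ?thesis by simp
qed

lemma card_equal_weight_combinations_0: "card (equal_weight_combinations 0 0) = 1"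
proof -
  have "index_sets_with_min 1 0 = {{0}}" by (auto simp: index_sets_with_min_def)
  then have "equal_weight_combinations 0 0 = {{0}}" by (auto simp: equal_weight_combinations_def)
  then show ?thesis by simp
qed

theorem theorem1:
  fixes M :: "nat \<Rightarrow> 'a measure" and T :: "nat \<Rightarrow> 'a \<Rightarrow> bit mat"
  assumes "\<And>m. m \<ge> 1 \<Longrightarrow> random_unitriangular (M m) (2 ^ m) (T m)"
  defines "P \<equiv> same_weight_prob M T"
  shows "P 1 1 = 1 \<and> P 1 2 = 1 \<and>
    (\<forall>m\<ge>2. \<forall>i\<in>{1..2 ^ m}.
       P m i = (if i \<le> 2 ^ (m - 1)
                then 2 ^ hamming_weight (f_row m i) / 2 ^ (2 ^ (m - 1)) * P (m - 1) i
                else P (m - 1) (i - 2 ^ (m - 1))))"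
proof -
  let ?C = "\<lambda>m r. card (equal_weight_combinations m r)"
  have P: "P m i = ?C m (i - 1) / 2 ^ (2 ^ m - i)" if "1 \<le> m" "1 \<le> i" "i \<le> 2 ^ m" for m i
    unfolding P_def using that by (intro same_weight_prob_eq assms(1))
  show ?thesis
  proof (intro conjI allI impI ballI)
    have "combination_support 0 {0} = {0}"
      by (auto simp: combination_support_def)
    \<comment> \<open>The counts make sense for size one too, although no random matrix is assumed
      there. They yield 2 and 1 at \<open>m = 1\<close>, over the denominators 2 and 1.\<close>
    then show "P 1 1 = 1" "P 1 2 = 1"
      using card_equal_weight_combinations_Suc[of 0 0] card_equal_weight_combinations_0
      by (simp_all add: P)
  next
    fix m i :: nat assume m: "2 \<le> m" and i: "i \<in> {1..2 ^ m}"
    obtain k where k: "m = Suc k" "1 \<le> k" using m by (cases m) auto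
    show "P m i = (if i \<le> 2 ^ (m - 1)
                  then 2 ^ hamming_weight (f_row m i) / 2 ^ (2 ^ (m - 1)) * P (m - 1) i
                  else P (m - 1) (i - 2 ^ (m - 1)))"
    proof (cases "i \<le> 2 ^ k")
      case True
      have "i - 1 < 2 ^ k" using True i by auto
      \<comment> \<open>A row in the first half has \<open>2 ^ k\<close> more free bits than at
        level \<open>k\<close>, while its fixed row keeps its weight.\<close>
      moreover have "(2 :: real) ^ (2 ^ m - i) = 2 ^ 2 ^ k * 2 ^ (2 ^ k - i)"
        using True k by (simp flip: power_add)
      ultimately show ?thesis
        using True i k by (simp add: P hamming_weight_f_row
          card_equal_weight_combinations_Suc card_combination_support_singleton_Suc)
    next
      case False
      \<comment> \<open>With this \<open>s\<close> the index from 0 is \<open>2 ^ k + s\<close>, and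
        both levels have \<open>2 ^ k - Suc s\<close> free bits.\<close>
      then obtain s where s: "i = 2 ^ k + Suc s"
        by (metis add_Suc_right less_imp_Suc_add not_le)
      then have "s < 2 ^ k" using i k by simp
      then show ?thesis
        using s k by (simp add: P card_equal_weight_combinations_Suc)
    qed
  qed
qed

end
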